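(* Let $A:[0,\infty)\to\mathbb{R}^{d\times d}$ be continuous. If the zero solution of $\dot y(t)=A(t)y$, $y(0)=0$, is uniformly asymptotically stable, then its $E(t)$ is bounded by a constant; i.e., there is a constant $K>0$ such that $E(t)<K$ for all $0\le t<\infty$.
   Context: Norms are Euclidean. Let $y(t;s,\eta)$ denote the solution of $\dot y=F(t,y)$ with $y(s)=\eta$; here $F(t,y)=A(t)y$. The zero solution is uniformly stable if for every $\epsilon>0$ there exists $\delta>0$ such that for all $\tau\ge0$ and all $\eta$ with $\|\eta\|<\delta$, $\|y(t;\tau,\eta)\|<\epsilon$ for all $t\ge\tau$. It is uniformly asymptotically stable if it is uniformly stable and the $\delta>0$ can be chosen so that in addition for every $\epsilon'>0$ there exists $T_{\epsilon'}$ such that $\|y(t;\tau,\eta)\|<\epsilon'$ for all $\tau\ge0$, all $t>\tau+T_{\epsilon'}$ and all $\eta$ with $\|\eta\|<\delta$. Definition of $E$: let $\alpha:[0,\infty)\to[0,\infty)$ be any continuous strictly increasing function with $\alpha(0)=0$. For $h>0$ the family $\tilde Y_\alpha(h)$ of approximations to the zero solution consists of all functions $\tilde y(\cdot;h)$ obtained from sequences $v_1,v_2,\dots\in\mathbb{R}^d$ with $\|v_n\|\le 1$ by $\tilde y(0;h)=0$, $\tilde y(nh;h)=y(nh;(n-1)h,\tilde y((n-1)h;h))+h\alpha(h)v_n$ for $n\ge1$, and $\tilde y(t;h)=y(t;(n-1)h,\tilde y((n-1)h;h))$ for $(n-1)h\le t<nh$. Define $e_\alpha(t;h)=\sup_{\tilde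 y\in\tilde Y_\alpha(h)}\|\tilde y(t;h)\|$ and $E(t)=E_\alpha(t)=\limsup_{h\to0^+} e_\alpha(t;h)/\alpha(h)$; this value does not depend on the choice of $\alpha$. *)

theory Defs
  imports "HOL-Analysis.Analysis"
begin

definition solves_ivp ::
    "(real \<Rightarrow> 'a::real_normed_vector \<Rightarrow> 'a) \<Rightarrow> real \<Rightarrow> 'a \<Rightarrow> (real \<Rightarrow> 'a) \<Rightarrow> bool" where
  "solves_ivp F s \<eta> y \<longleftrightarrow>
     y s = \<eta> \<and> (\<forall>t\<ge>s. (y has_vector_derivative F t (y t)) (at t within {s..}))"

(* sol F t s \<eta> is y(t; s, \<eta>). It is only meaningful for t \<ge> s (the values of a solution before s
   are unconstrained), and when the initial value problem has a unique solution on [s, \<infinity>), as it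
   does for F t y = A t *v y with A continuous on [0, \<infinity>) and s \<ge> 0. *)
definition sol ::
    "(real \<Rightarrow> 'a::real_normed_vector \<Rightarrow> 'a) \<Rightarrow> real \<Rightarrow> real \<Rightarrow> 'a \<Rightarrow> 'a" where
  "sol F t s \<eta> = (THE x. \<exists>y. solves_ivp F s \<eta> y \<and> y t = x)"

definition uniformly_stable :: "(real \<Rightarrow> 'a::real_normed_vector \<Rightarrow> 'a) \<Rightarrow> bool" where
  "uniformly_stable F \<longleftrightarrow>
     (\<forall>\<epsilon>>0. \<exists>\<delta>>0. \<forall>\<tau>\<ge>0. \<forall>\<eta>. norm \<eta> < \<delta> \<longrightarrow> (\<forall>t\<ge>\<tau>. norm (sol F t \<tau> \<eta>) < \<epsilon>))"

(* The same \<delta> serves for stability and for attraction. The condition T \<ge> 0 keeps t > \<tau> + T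
   inside the range t \<ge> \<tau> where sol is meaningful. *)
definition uniformly_asymptotically_stable ::
    "(real \<Rightarrow> 'a::real_normed_vector \<Rightarrow> 'a) \<Rightarrow> bool" where
  "uniformly_asymptotically_stable F \<longleftrightarrow>
     uniformly_stable F \<and>
     (\<forall>\<epsilon>>0. \<exists>\<delta>>0.
        (\<forall>\<tau>\<ge>0. \<forall>\<eta>. norm \<eta> < \<delta> \<longrightarrow> (\<forall>t\<ge>\<tau>. norm (sol F t \<tau> \<eta>) < \<epsilon>)) \<and>
        (\<forall>\<epsilon>'>0. \<exists>T\<ge>0. \<forall>\<tau>\<ge>0. \<forall>t>\<tau> + T. \<forall>\<eta>. norm \<eta> < \<delta> \<longrightarrow> norm (sol F t \<tau> \<eta>) < \<epsilon>'))"

definition gauge_fun :: "(real \<Rightarrow> real) \<Rightarrow> bool" where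
  "gauge_fun \<alpha> \<longleftrightarrow>
     \<alpha> ` {0..} \<subseteq> {0..} \<and> continuous_on {0..} \<alpha> \<and> strict_mono_on {0..} \<alpha> \<and> \<alpha> 0 = 0"

(* Members are functions on [0, \<infinity>); their values at negative arguments are unconstrained. *)
definition approximations ::
    "(real \<Rightarrow> 'a::real_normed_vector \<Rightarrow> 'a) \<Rightarrow> (real \<Rightarrow> real) \<Rightarrow> real \<Rightarrow> (real \<Rightarrow> 'a) set" where
  "approximations F \<alpha> h =
     {y. \<exists>v :: nat \<Rightarrow> 'a. (\<forall>n\<ge>1. norm (v n) \<le> 1) \<and> y 0 = 0 \<and>
        (\<forall>n\<ge>1. y (real n * h) =
            sol F (real n * h) ((real n - 1) * h) (y ((real n - 1) * h)) + (h * \<alpha> h) *\<^sub>R v n) \<and>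
        (\<forall>n\<ge>1. \<forall>t. (real n - 1) * h \<le> t \<and> t < real n * h \<longrightarrow>
            y t = sol F t ((real n - 1) * h) (y ((real n - 1) * h)))}"

definition approx_error ::
    "(real \<Rightarrow> 'a::real_normed_vector \<Rightarrow> 'a) \<Rightarrow> (real \<Rightarrow> real) \<Rightarrow> real \<Rightarrow> real \<Rightarrow> ereal" where
  "approx_error F \<alpha> t h = (SUP y\<in>approximations F \<alpha> h. ereal (norm (y t)))"

definition error_coeff ::
    "(real \<Rightarrow> 'a::real_normed_vector \<Rightarrow> 'a) \<Rightarrow> (real \<Rightarrow> real) \<Rightarrow> real \<Rightarrow> ereal" where
  "error_coeff F \<alpha> t = Limsup (at_right 0) (\<lambda>h. approx_error F \<alpha> t h / ereal (\<alpha> h))"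

end

theory Submission
  imports Defs
begin

text \<open>Stability and linearity give a bound \<open>C\<close> for the norms of all evolution maps
  \<open>\<Phi>(t, s)\<close>, and uniform attraction makes \<open>\<Phi>(t, s)\<close> a contraction by \<open>1/2\<close> once \<open>t - s\<close> exceeds
  some \<open>T\<close>. Over \<open>m\<close> steps covering a window of length \<open>m h > T\<close>, the injected errors contribute at
  most \<open>C m h \<alpha>(h)\<close>, while the error inherited from the start of the window is halved. Hence the
  error at grid points stays below \<open>2 C m h \<alpha>(h)\<close>, where \<open>m h\<close> may be kept below \<open>T + 2\<close> as \<open>h \<rightarrow> 0\<close>.\<close>

section \<open>Linear differential equations\<close>

lemma at_within_atLeast_eq_atLeastAtMost:
  fixes s t b :: real
  assumes "t < b"
  shows "at t within {s..} = at t within {s..b}"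
  using assms by (intro at_within_nhd[of t "{..<b}"]) auto

text \<open>Gronwall in energy form: if \<open>M\<close> bounds the operator norm on the compact
  interval up to \<open>t\<close>, then damping the squared norm of \<open>z\<close> by
  \<open>exp (- (2 * M * u))\<close> makes it nonincreasing, and it starts at 0. Squaring avoids
  differentiating the norm at 0.\<close>

lemma linear_ode_zero_unique:
  fixes A :: "real \<Rightarrow> 'a::real_inner \<Rightarrow>\<^sub>L 'a"
  assumes A: "continuous_on {s..} A"
    and z: "solves_ivp (\<lambda>t. blinfun_apply (A t)) s 0 z" and t: "s \<le> t"
  shows "z t = 0"
proof -
  have zd: "(z has_vector_derivative A u (z u)) (at u within {s..})" if "s \<le> u" for u
    using z that by (simp add: solves_ivp_def)
  have "bounded (A ` {s..t})"
    by (intro compact_imp_bounded compact_continuous_image continuous_on_subset[OF A]) auto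
  then obtain M where M: "\<And>u. u \<in> {s..t} \<Longrightarrow> norm (A u) \<le> M"
    unfolding bounded_iff by blast
  define g where "g u = exp (- (2 * M * u)) * (z u \<bullet> z u)" for u
  have gd: "(g has_real_derivative
      exp (- (2 * M * u)) * (2 * (z u \<bullet> A u (z u)) - 2 * M * (z u \<bullet> z u))) (at u within {s..})"
    if "s \<le> u" for u
  proof -
    have "((\<lambda>u. z u \<bullet> z u) has_real_derivative 2 * (z u \<bullet> A u (z u))) (at u within {s..})"
      using bounded_bilinear.has_vector_derivative[OF bounded_bilinear_inner zd[OF that] zd[OF that]]
      by (simp add: has_real_derivative_iff_has_vector_derivative inner_commute)
    moreover have "((\<lambda>u. exp (- (2 * M * u))) has_real_derivative
        exp (- (2 * M * u)) * - (2 * M)) (at u within {s..})"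
      by (rule derivative_eq_intros refl | simp)+
    ultimately show ?thesis
      unfolding g_def using DERIV_mult by (fastforce simp: algebra_simps)
  qed
  have "g t \<le> g s"
  proof (rule DERIV_nonpos_imp_decreasing_open[OF t])
    fix u assume u: "s < u" "u < t"
    have "z u \<bullet> A u (z u) \<le> norm (z u) * norm (A u (z u))"
      by (rule norm_cauchy_schwarz)
    also have "\<dots> \<le> norm (z u) * (M * norm (z u))"
      using M[of u] u by (intro mult_left_mono order_trans[OF norm_blinfun mult_right_mono]) auto
    also have "\<dots> = M * (z u \<bullet> z u)"
      by (simp add: dot_square_norm power2_eq_square)
    finally have "exp (- (2 * M * u)) * (2 * (z u \<bullet> A u (z u)) - 2 * M * (z u \<bullet> z u)) \<le> 0"
      by (simp add: mult_le_0_iff)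
    moreover have "at u within {s..} = at u"
      using u by (intro at_within_interior) auto
    ultimately show "\<exists>y. DERIV g u :> y \<and> y \<le> 0"
      using gd[of u] u by auto
  next
    show "continuous_on {s..t} g"
      by (rule continuous_on_subset[of "{s..}"], rule DERIV_continuous_on[OF gd]) auto
  qed
  moreover have "g s = 0"
    using z by (simp add: g_def solves_ivp_def)
  ultimately have "exp (- (2 * M * t)) * (z t \<bullet> z t) \<le> 0"
    by (simp add: g_def)
  then have "z t \<bullet> z t \<le> 0"
    by (simp add: mult_le_0_iff)
  then show ?thesis
    by (metis inner_gt_zero_iff not_le)
qed

lemma linear_ode_unique:
  fixes A :: "real \<Rightarrow> 'a::real_inner \<Rightarrow>\<^sub>L 'a"
  assumes A: "continuous_on {s..} A"
    and y: "solves_ivp (\<lambda>t. blinfun_apply (A t)) s \<eta> y"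
    and z: "solves_ivp (\<lambda>t. blinfun_apply (A t)) s \<eta> z" and t: "s \<le> t"
  shows "y t = z t"
proof -
  have "solves_ivp (\<lambda>t. blinfun_apply (A t)) s 0 (\<lambda>t. y t - z t)"
    using y z by (auto simp: solves_ivp_def blinfun.diff_right intro!: has_vector_derivative_diff)
  from linear_ode_zero_unique[OF A this t] show ?thesis by simp
qed

section \<open>Existence by the Picard series\<close>

text \<open>By linearity these iterated integrals are the differences of successive Picard iterates,
  so the solution is their sum.\<close>

primrec picard_term ::
    "(real \<Rightarrow> 'a::real_normed_vector \<Rightarrow>\<^sub>L 'a) \<Rightarrow> real \<Rightarrow> 'a \<Rightarrow> nat \<Rightarrow> real \<Rightarrow> 'a" where
  "picard_term A s \<eta> 0 = (\<lambda>t. \<eta>)"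
| "picard_term A s \<eta> (Suc n) = (\<lambda>t. integral {s..t} (\<lambda>u. A u (picard_term A s \<eta> n u)))"

lemma continuous_on_picard_term:
  fixes A :: "real \<Rightarrow> 'a::banach \<Rightarrow>\<^sub>L 'a"
  assumes A: "continuous_on {s..b} A"
  shows "continuous_on {s..b} (picard_term A s \<eta> n)"
proof (induction n)
  case (Suc n)
  have "continuous_on {s..b} (\<lambda>u. A u (picard_term A s \<eta> n u))"
    by (intro continuous_intros A Suc)
  then show ?case
    by (simp add: indefinite_integral_continuous_1 integrable_continuous_interval)
qed simp

lemma picard_term_has_vector_derivative:
  fixes A :: "real \<Rightarrow> 'a::banach \<Rightarrow>\<^sub>L 'a"
  assumes A: "continuous_on {s..b} A" and t: "t \<in> {s..b}"
  shows "(picard_term A s \<eta> (Suc n) has_vector_derivative A t (picard_term A s \<eta> n t))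
    (at t within {s..b})"
proof -
  have "continuous_on {s..b} (\<lambda>u. A u (picard_term A s \<eta> n u))"
    by (intro continuous_intros A continuous_on_picard_term)
  from integral_has_vector_derivative[OF this t] show ?thesis by simp
qed

text \<open>Each integration gains a factor \<open>M * (t - s) / (n + 1)\<close>; the factorial
  makes the Picard series converge on every bounded interval.\<close>

lemma norm_picard_term_le:
  fixes A :: "real \<Rightarrow> 'a::banach \<Rightarrow>\<^sub>L 'a"
  assumes A: "continuous_on {s..b} A" and M: "\<And>u. u \<in> {s..b} \<Longrightarrow> norm (A u) \<le> M" and "M \<ge> 0"
    and "t \<in> {s..b}"
  shows "norm (picard_term A s \<eta> n t) \<le> norm \<eta> * (M * (t - s)) ^ n / fact n"
  using \<open>t \<in> {s..b}\<close>
proof (induction n arbitrary: t)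
  case (Suc n)
  let ?p = "picard_term A s \<eta>"
  \<comment> \<open>The claimed bound for \<open>Suc n\<close>; its derivative is \<open>M\<close>
    times the bound for \<open>n\<close>, which dominates the derivative of the next Picard
    term.\<close>
  let ?\<phi> = "\<lambda>u. norm \<eta> * (M * (u - s)) ^ Suc n / fact (Suc n)"
  have \<phi>: "(?\<phi> has_vector_derivative M * (norm \<eta> * (M * (u - s)) ^ n / fact n)) (at u)" for u
    unfolding has_real_derivative_iff_has_vector_derivative[symmetric]
    by (rule derivative_eq_intros refl | simp)+
  show ?case
  \<comment> \<open>The mean value inequality used below needs a nondegenerate interval.\<close>
  proof (cases "t = s")
    case False
    with Suc.prems have st: "s < t" "t \<le> b" by auto
    have "norm (?p (Suc n) t - ?p (Suc n) s) \<le> ?\<phi> t - ?\<phi> s"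
    proof (rule differentiable_bound_general[OF st(1)])
      show "continuous_on {s..t} (?p (Suc n))"
        by (rule continuous_on_subset[OF continuous_on_picard_term[OF A]]) (use st in auto)
      show "continuous_on {s..t} ?\<phi>"
        by (intro continuous_intros) auto
      fix u assume u: "s < u" "u < t"
      have "at u within {s..b} = at u"
        using u st by (intro at_within_interior) auto
      then show "(?p (Suc n) has_vector_derivative A u (?p n u)) (at u)"
        using picard_term_has_vector_derivative[OF A, of u \<eta> n] u st by simp
      show "(?\<phi> has_vector_derivative M * (norm \<eta> * (M * (u - s)) ^ n / fact n)) (at u)"
        by (rule \<phi>)
      show "norm (A u (?p n u)) \<le> M * (norm \<eta> * (M * (u - s)) ^ n / fact n)"
        by (rule order_trans[OF norm_blinfun mult_mono])
          (use Suc.IH[of u] M[of u] \<open>M \<ge> 0\<close> u st in auto)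
    qed
    then show ?thesis by simp
  qed auto
qed simp

lemma linear_ode_exists:
  fixes A :: "real \<Rightarrow> 'a::banach \<Rightarrow>\<^sub>L 'a"
  assumes A: "continuous_on {s..} A"
  shows "\<exists>y. solves_ivp (\<lambda>t. blinfun_apply (A t)) s \<eta> y"
proof -
  define p where "p = picard_term A s \<eta>"
  define y where "y t = (\<Sum>n. p n t)" for t
  \<comment> \<open>\<open>d n\<close> is the derivative of \<open>p n\<close>: zero for the
    constant term, and shifted by one index after it, so the sum of the \<open>d n\<close> is
    \<open>A\<close> applied to \<open>y\<close>.\<close>
  define d where "d n t = (case n of 0 \<Rightarrow> 0 | Suc k \<Rightarrow> A t (p k t))" for n t
  have yd: "(y has_vector_derivative A t (y t)) (at t within {s..})" if "s \<le> t" for t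
  proof -
    \<comment> \<open>A compact interval gives uniform bounds; placing \<open>t\<close> strictly
      below its right end leaves the derivative at \<open>t\<close> within \<open>{s..}\<close>
      unchanged.\<close>
    define b where "b = t + 1"
    have Ab: "continuous_on {s..b} A"
      using A by (rule continuous_on_subset) auto
    have "bounded (A ` {s..b})"
      by (intro compact_imp_bounded compact_continuous_image Ab) auto
    then obtain M where "M > 0" and M: "\<And>u. u \<in> {s..b} \<Longrightarrow> norm (A u) \<le> M"
      unfolding bounded_pos by blast
    define c where "c n = norm \<eta> * ((M * (b - s)) ^ n / fact n)" for n
    have "summable (\<lambda>n. (M * (b - s)) ^ n / fact n)"
      using summable_exp[of "M * (b - s)"] by (simp add: field_simps)
    then have c: "summable c"
      unfolding c_def by (rule summable_mult)
    have pc: "norm (p n u) \<le> c n" if u: "u \<in> {s..b}" for n u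
    proof -
      have "norm (p n u) \<le> norm \<eta> * (M * (u - s)) ^ n / fact n"
        unfolding p_def using \<open>M > 0\<close> u by (intro norm_picard_term_le[OF Ab M]) auto
      also have "\<dots> \<le> c n"
        unfolding c_def times_divide_eq_right[symmetric] using \<open>M > 0\<close> u
        by (intro mult_left_mono divide_right_mono power_mono) auto
      finally show ?thesis .
    qed
    have ps: "summable (\<lambda>n. p n u)" if "u \<in> {s..b}" for u
      by (rule summable_comparison_test'[OF c]) (use pc that in auto)
    define e where "e n = (case n of 0 \<Rightarrow> 0 | Suc k \<Rightarrow> M * c k)" for n
    have "summable (\<lambda>n. e (Suc n))"
      using c by (simp add: e_def summable_mult)
    then have e: "summable e"
      by (simp only: summable_Suc_iff)
    have de: "norm (d n u) \<le> e n" if "u \<in> {s..b}" for n u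
    proof (cases n)
      case (Suc k)
      have "norm (A u (p k u)) \<le> M * c k"
        by (rule order_trans[OF norm_blinfun mult_mono]) (use pc M that \<open>M > 0\<close> in auto)
      then show ?thesis by (simp add: d_def e_def Suc)
    qed (simp add: d_def e_def)
    have dsum: "(\<Sum>n. d n u) = A u (y u)" if u: "u \<in> {s..b}" for u
    proof -
      have "summable (\<lambda>n. d n u)"
        by (rule summable_comparison_test'[OF e]) (use de u in auto)
      then have "(\<Sum>n. d n u) = (\<Sum>n. A u (p n u))"
        using suminf_split_head[of "\<lambda>n. d n u"] by (simp add: d_def)
      also have "\<dots> = A u (y u)"
        unfolding y_def by (rule bounded_linear.suminf[OF blinfun.bounded_linear_right ps[OF u], symmetric])
      finally show ?thesis .
    qed
    \<comment> \<open>Uniform convergence of the differentiated series is what permits termwise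
      differentiation.\<close>
    have lim: "uniform_limit {s..b} (\<lambda>n u. \<Sum>i<n. d i u) (\<lambda>u. \<Sum>i. d i u) sequentially"
      by (rule Weierstrass_m_test[OF de e])
    have "\<exists>g. \<forall>u\<in>{s..b}. (\<lambda>n. p n u) sums g u \<and>
        (g has_derivative (\<lambda>h. h *\<^sub>R (\<Sum>i. d i u))) (at u within {s..b})"
    proof (rule has_derivative_series)
      show "convex {s..b}" by simp
      show "(p n has_derivative (\<lambda>h. h *\<^sub>R d n u)) (at u within {s..b})" if "u \<in> {s..b}" for n u
        unfolding has_vector_derivative_def[symmetric]
        using picard_term_has_vector_derivative[OF Ab that]
        by (cases n) (simp_all add: p_def d_def del: picard_term.simps(2))
      show "\<forall>\<^sub>F n in sequentially. \<forall>u\<in>{s..b}. \<forall>h.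
          norm ((\<Sum>i<n. h *\<^sub>R d i u) - h *\<^sub>R (\<Sum>i. d i u)) \<le> r * norm h" if "r > 0" for r
        using uniform_limitD[OF lim that]
      proof (eventually_elim, intro ballI allI)
        fix n u and h :: real
        assume n: "\<forall>u\<in>{s..b}. dist (\<Sum>i<n. d i u) (\<Sum>i. d i u) < r" and u: "u \<in> {s..b}"
        have "norm ((\<Sum>i<n. h *\<^sub>R d i u) - h *\<^sub>R (\<Sum>i. d i u))
            = \<bar>h\<bar> * dist (\<Sum>i<n. d i u) (\<Sum>i. d i u)"
          by (simp add: dist_norm flip: scaleR_sum_right scaleR_diff_right)
        also have "\<dots> \<le> \<bar>h\<bar> * r"
          using n u by (intro mult_left_mono) (auto intro: less_imp_le)
        finally show "norm ((\<Sum>i<n. h *\<^sub>R d i u) - h *\<^sub>R (\<Sum>i. d i u)) \<le> r * norm h"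
          by (simp add: mult.commute)
      qed
      show "s \<in> {s..b}" using that by (simp add: b_def)
      then show "(\<lambda>n. p n s) sums y s"
        unfolding y_def by (intro summable_sums ps)
    qed
    then obtain g where g: "\<And>u. u \<in> {s..b} \<Longrightarrow> (\<lambda>n. p n u) sums g u"
      and gd: "\<And>u. u \<in> {s..b} \<Longrightarrow> (g has_vector_derivative (\<Sum>i. d i u)) (at u within {s..b})"
      unfolding has_vector_derivative_def by blast
    have tb: "t \<in> {s..b}" using that by (simp add: b_def)
    have "(y has_vector_derivative (\<Sum>i. d i t)) (at t within {s..b})"
      unfolding y_def
      by (rule has_vector_derivative_transform[OF tb _ gd[OF tb]]) (rule sums_unique[OF g, symmetric])
    then show ?thesis
      using dsum[OF tb] at_within_atLeast_eq_atLeastAtMost[of t b s] by (simp add: b_def)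
  qed
  have "p (Suc n) s = 0" for n by (simp add: p_def)
  then have "p n s = 0" if "n \<notin> {0}" for n
    using that by (cases n) auto
  then have "y s = (\<Sum>n\<in>{0}. p n s)"
    unfolding y_def by (intro suminf_finite) auto
  then have "y s = \<eta>" by (simp add: p_def)
  with yd show ?thesis
    unfolding solves_ivp_def by blast
qed

section \<open>Evolution families\<close>

text \<open>Isolates the algebra of the solution operators, so that the error estimates no longer
  refer to the differential equation. The laws are restricted to 0 \<le> s \<le> t, where
  \<open>sol\<close> is meaningful.\<close>

locale evolution_family =
  fixes \<Phi> :: "real \<Rightarrow> real \<Rightarrow> 'a::real_normed_vector \<Rightarrow> 'a"
  assumes linear: "0 \<le> s \<Longrightarrow> s \<le> t \<Longrightarrow> linear (\<Phi> t s)"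
    and id: "0 \<le> s \<Longrightarrow> \<Phi> s s x = x"
    and cocycle: "0 \<le> s \<Longrightarrow> s \<le> r \<Longrightarrow> r \<le> t \<Longrightarrow> \<Phi> t r (\<Phi> r s x) = \<Phi> t s x"

text \<open>Existence and uniqueness give the description in \<open>sol\<close> its value;
  superposition then yields linearity, and restarting a solution at a later time yields the cocycle
  law.\<close>

lemma evolution_family_linear_ode:
  fixes A :: "real \<Rightarrow> 'a::{real_inner, banach} \<Rightarrow>\<^sub>L 'a"
  assumes A: "continuous_on {0..} A"
  shows "evolution_family (sol (\<lambda>t. blinfun_apply (A t)))"
proof (rule evolution_family.intro)
  let ?F = "\<lambda>t. blinfun_apply (A t)"
  have As: "continuous_on {s..} A" if "0 \<le> s" for s
    using A by (rule continuous_on_subset) (use that in auto)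
  have sol: "sol ?F t s \<eta> = y t" if "solves_ivp ?F s \<eta> y" "0 \<le> s" "s \<le> t" for t s \<eta> y
    unfolding sol_def using that linear_ode_unique[OF As[OF that(2)]]
    by (intro the_equality) blast+
  have ex: "\<exists>y. solves_ivp ?F s \<eta> y" if "0 \<le> s" for s \<eta>
    by (rule linear_ode_exists[OF As[OF that]])
  show "sol ?F s s \<eta> = \<eta>" if s: "0 \<le> s" for s \<eta>
    using ex[OF s, of \<eta>] sol[OF _ s order_refl, of \<eta>] by (auto simp: solves_ivp_def)
  show "linear (sol ?F t s)" if s: "0 \<le> s" and t: "s \<le> t" for s t
  proof (rule linearI)
    fix x x' :: 'a and c :: real
    obtain y y' where y: "solves_ivp ?F s x y" and y': "solves_ivp ?F s x' y'"
      using ex[OF s] by blast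
    have "solves_ivp ?F s (x + x') (\<lambda>u. y u + y' u)"
      using y y' by (auto simp: solves_ivp_def blinfun.add_right intro!: has_vector_derivative_add)
    then show "sol ?F t s (x + x') = sol ?F t s x + sol ?F t s x'"
      using sol y y' s t by simp
    have "solves_ivp ?F s (c *\<^sub>R x) (\<lambda>u. c *\<^sub>R y u)"
      using y by (auto simp: solves_ivp_def blinfun.scaleR_right
          intro!: bounded_linear.has_vector_derivative[OF bounded_linear_scaleR_right])
    then show "sol ?F t s (c *\<^sub>R x) = c *\<^sub>R sol ?F t s x"
      using sol y s t by simp
  qed
  show "sol ?F t r (sol ?F r s \<eta>) = sol ?F t s \<eta>"
    if s: "0 \<le> s" and r: "s \<le> r" "r \<le> t" for s r t \<eta>
  proof -
    obtain y where y: "solves_ivp ?F s \<eta> y"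
      using ex[OF s] by blast
    then have "solves_ivp ?F r (y r) y"
      using r by (auto simp: solves_ivp_def 
          intro!: has_vector_derivative_within_subset[of y _ _ "{s..}" "{r..}"])
    then show ?thesis
      using sol y s r by simp
  qed
qed

section \<open>Propagation of errors along perturbed orbits\<close>

lemma linear_norm_le_of_ball:
  fixes L :: "'a::real_normed_vector \<Rightarrow> 'b::real_normed_vector"
  assumes "linear L" "\<delta> > 0" and L: "\<And>x. norm x < \<delta> \<Longrightarrow> norm (L x) < \<epsilon>"
  shows "norm (L x) \<le> 2 * \<epsilon> / \<delta> * norm x"
proof (cases "x = 0")
  case False
  \<comment> \<open>Rescales \<open>x\<close> to norm \<open>\<delta> / 2\<close>, strictly inside
    the ball; hence the factor 2 in the bound.\<close>
  define c where "c = \<delta> / (2 * norm x)"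
  have "c > 0" using False \<open>\<delta> > 0\<close> by (simp add: c_def)
  have "norm (c *\<^sub>R x) < \<delta>" using False \<open>\<delta> > 0\<close> by (simp add: c_def)
  then have "norm (L (c *\<^sub>R x)) < \<epsilon>" by (rule L)
  then have "c * norm (L x) < \<epsilon>"
    using \<open>c > 0\<close> by (simp add: linear_cmul[OF \<open>linear L\<close>])
  then show ?thesis
    using False \<open>\<delta> > 0\<close> by (simp add: c_def field_simps)
qed (simp add: linear_0[OF \<open>linear L\<close>])

text \<open>All states are transported to one fixed time \<open>t\<close> before being compared. One
  more step then changes the transported state only by the transported new error, so
  \<open>C\<close> enters once per error and the bound grows linearly in \<open>k\<close> instead of
  like a power of \<open>C\<close>.\<close>

lemma (in evolution_family) perturbed_orbit_deviation:
  assumes C: "\<And>s t x. 0 \<le> s \<Longrightarrow> s \<le> t \<Longrightarrow> norm (\<Phi> t s x) \<le> C * norm x"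
    and h: "h \<ge> 0" and "C \<ge> 0"
    and rec: "\<And>n. Y (Suc n) = \<Phi> (real (Suc n) * h) (real n * h) (Y n) + w n"
    and w: "\<And>n. norm (w n) \<le> \<beta>"
    and t: "real (n + k) * h \<le> t"
  shows "norm (\<Phi> t (real (n + k) * h) (Y (n + k)) - \<Phi> t (real n * h) (Y n)) \<le> real k * (C * \<beta>)"
  using t
proof (induction k)
  case (Suc k)
  let ?a = "real (n + k) * h" and ?b = "real (n + Suc k) * h"
  have ab: "0 \<le> ?a" "?a \<le> ?b" "?b \<le> t"
    using h Suc.prems by (auto intro: mult_right_mono)
  have b0: "0 \<le> ?b" using ab by linarith
  have "\<Phi> t ?b (Y (n + Suc k)) = \<Phi> t ?a (Y (n + k)) + \<Phi> t ?b (w (n + k))"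
    using rec[of "n + k"] linear_add[OF linear[OF b0 ab(3)]] cocycle[OF ab]
    by simp
  then have "norm (\<Phi> t ?b (Y (n + Suc k)) - \<Phi> t (real n * h) (Y n))
      = norm ((\<Phi> t ?a (Y (n + k)) - \<Phi> t (real n * h) (Y n)) + \<Phi> t ?b (w (n + k)))"
    by (simp add: algebra_simps)
  also have "\<dots> \<le> norm (\<Phi> t ?a (Y (n + k)) - \<Phi> t (real n * h) (Y n)) + norm (\<Phi> t ?b (w (n + k)))"
    by (rule norm_triangle_ineq)
  also have "\<dots> \<le> real k * (C * \<beta>) + C * \<beta>"
    by (rule add_mono[OF Suc.IH order_trans[OF C[OF b0 ab(3)]]])
      (use ab w \<open>C \<ge> 0\<close> in \<open>auto intro: mult_left_mono\<close>)
  finally show ?case by (simp add: algebra_simps)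
qed simp

text \<open>The bound \<open>b\<close> solves \<open>b = b / 2 + real m * (C * \<beta>)\<close>, so
  it reproduces itself from one window of \<open>m\<close> steps to the next.\<close>

lemma (in evolution_family) perturbed_orbit_bound:
  assumes C: "\<And>s t x. 0 \<le> s \<Longrightarrow> s \<le> t \<Longrightarrow> norm (\<Phi> t s x) \<le> C * norm x"
    and half: "\<And>s t x. 0 \<le> s \<Longrightarrow> s + T < t \<Longrightarrow> norm (\<Phi> t s x) \<le> norm x / 2"
    and h: "h \<ge> 0" and "C \<ge> 0"
    and rec: "\<And>n. Y (Suc n) = \<Phi> (real (Suc n) * h) (real n * h) (Y n) + w n"
    and w: "\<And>n. norm (w n) \<le> \<beta>" and "Y 0 = 0"
    and m: "T < real m * h" "m > 0"
  shows "norm (Y n) \<le> 2 * real m * (C * \<beta>)"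
proof (induction n rule: less_induct)
  case (less n)
  note dev = perturbed_orbit_deviation[OF C h \<open>C \<ge> 0\<close> rec w]
  have "C * \<beta> \<ge> 0"
    using w[of 0] \<open>C \<ge> 0\<close> by (meson mult_nonneg_nonneg norm_ge_zero order_trans)
  have nh: "0 \<le> real n * h" for n using h by simp
  show ?case
  proof (cases "n \<le> m")
    \<comment> \<open>Before a full window has passed, the comparison is with the unperturbed orbit
      of 0, which stays 0 by linearity.\<close>
    case True
    have "norm (Y n) \<le> real n * (C * \<beta>)"
      using dev[of 0 n "real n * h"] linear_0[OF linear[OF order_refl nh]] id[OF nh] \<open>Y 0 = 0\<close>
      by simp
    also have "\<dots> \<le> 2 * real m * (C * \<beta>)"
      using True \<open>C * \<beta> \<ge> 0\<close> by (intro mult_right_mono) auto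
    finally show ?thesis .
  next
    case False
    \<comment> \<open>Goes back exactly one window, whose length exceeds \<open>T\<close>, so that
      \<open>half\<close> applies to the inherited error.\<close>
    define l where "l = n - m"
    have l: "l < n" "n = l + m" using False m by (auto simp: l_def)
    have "norm (\<Phi> (real n * h) (real l * h) (Y l)) \<le> norm (Y l) / 2"
      using m(1) l by (intro half nh) (simp add: algebra_simps)
    also have "\<dots> \<le> real m * (C * \<beta>)"
      using less[OF l(1)] by simp
    finally have "norm (\<Phi> (real n * h) (real l * h) (Y l)) \<le> real m * (C * \<beta>)" .
    moreover have "norm (Y n - \<Phi> (real n * h) (real l * h) (Y l)) \<le> real m * (C * \<beta>)"
      using dev[of l m "real n * h"] unfolding l(2)[symmetric] id[OF nh] by simp
    ultimately show ?thesis
      using norm_triangle_sub[of "Y n" "\<Phi> (real n * h) (real l * h) (Y l)"] by linarith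
  qed
qed

section \<open>From perturbed orbits to the error coefficient\<close>

text \<open>One factor \<open>C\<close> comes from the bound at grid points, the other from moving
  from the last grid point to \<open>t\<close>. The factor \<open>h\<close> in the injected errors
  is absorbed by the window length \<open>real m * h\<close>, leaving a multiple of
  \<open>\<alpha> h\<close> independent of \<open>h\<close> and \<open>t\<close>.\<close>

lemma approximations_norm_le:
  assumes ev: "evolution_family (sol F)"
    and C: "\<And>s t x. 0 \<le> s \<Longrightarrow> s \<le> t \<Longrightarrow> norm (sol F t s x) \<le> C * norm x"
    and half: "\<And>s t x. 0 \<le> s \<Longrightarrow> s + T < t \<Longrightarrow> norm (sol F t s x) \<le> norm x / 2"
    and "T \<ge> 0" "C \<ge> 0" and h: "0 < h" "h \<le> 1" and \<alpha>: "\<alpha> h \<ge> 0" and "t \<ge> 0"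
    and y: "y \<in> approximations F \<alpha> h"
  shows "norm (y t) \<le> 2 * C\<^sup>2 * (T + 2) * \<alpha> h"
proof -
  interpret evolution_family "sol F" by (rule ev)
  obtain v where v: "\<And>n. n \<ge> 1 \<Longrightarrow> norm (v n) \<le> 1" and "y 0 = 0"
    and step: "\<And>n. n \<ge> 1 \<Longrightarrow> y (real n * h) =
      sol F (real n * h) ((real n - 1) * h) (y ((real n - 1) * h)) + (h * \<alpha> h) *\<^sub>R v n"
    and between: "\<And>n t. n \<ge> 1 \<Longrightarrow> (real n - 1) * h \<le> t \<Longrightarrow> t < real n * h \<Longrightarrow>
      y t = sol F t ((real n - 1) * h) (y ((real n - 1) * h))"
    using y unfolding approximations_def by blast
  \<comment> \<open>The least number of steps whose total length strictly exceeds \<open>T\<close>;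
    since \<open>h\<close> is at most 1, the overshoot stays bounded.\<close>
  define m where "m = nat (\<lfloor>T / h\<rfloor> + 1)"
  have rm: "real m = of_int \<lfloor>T / h\<rfloor> + 1" "m > 0"
    using \<open>T \<ge> 0\<close> h by (auto simp: m_def)
  have "T / h < real m" using rm(1) by linarith
  then have mT: "T < real m * h" using h by (simp add: field_simps)
  have "real m \<le> T / h + 1" using rm(1) by linarith
  then have "real m * h \<le> (T / h + 1) * h" using h by (intro mult_right_mono) auto
  also have "\<dots> \<le> T + 2" using h by (simp add: field_simps)
  finally have mh: "real m * h \<le> T + 2" .
  define n where "n = nat \<lfloor>t / h\<rfloor>"
  have "real n = of_int \<lfloor>t / h\<rfloor>"
    using \<open>t \<ge> 0\<close> h by (auto simp: n_def)
  then have "real n \<le> t / h" "t / h < real (Suc n)" by linarith+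
  then have n: "real n * h \<le> t" "t < real (Suc n) * h"
    using h by (auto simp: field_simps)
  have "norm (y (real n * h)) \<le> 2 * real m * (C * (h * \<alpha> h))"
  \<comment> \<open>The errors \<open>v\<close> are numbered from 1, those of the orbit lemma from
    0; hence the shift by \<open>Suc\<close>.\<close>
  proof (rule perturbed_orbit_bound[where w = "\<lambda>n. (h * \<alpha> h) *\<^sub>R v (Suc n)", OF C half _ \<open>C \<ge> 0\<close>])
    show "y (real (Suc k) * h) = sol F (real (Suc k) * h) (real k * h) (y (real k * h))
        + (h * \<alpha> h) *\<^sub>R v (Suc k)" for k
      using step[of "Suc k"] by simp
    show "norm ((h * \<alpha> h) *\<^sub>R v (Suc k)) \<le> h * \<alpha> h" for k
      using v[of "Suc k"] h \<alpha> by (simp add: mult_left_le)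
  qed (use h mT rm \<open>y 0 = 0\<close> in auto)
  also have "\<dots> = 2 * C * \<alpha> h * (real m * h)" by (simp add: algebra_simps)
  also have "\<dots> \<le> 2 * C * \<alpha> h * (T + 2)"
    using mh \<open>C \<ge> 0\<close> \<alpha> by (intro mult_left_mono) auto
  finally have *: "norm (y (real n * h)) \<le> 2 * C * \<alpha> h * (T + 2)" .
  have "y t = sol F t (real n * h) (y (real n * h))"
    using between[of "Suc n" t] n by simp
  then have "norm (y t) \<le> C * norm (y (real n * h))"
    using C[of "real n * h" t] n h by simp
  also have "\<dots> \<le> C * (2 * C * \<alpha> h * (T + 2))"
    using * \<open>C \<ge> 0\<close> by (intro mult_left_mono)
  finally show ?thesis by (simp add: power2_eq_square algebra_simps)
qed

lemma error_coeff_le: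
  assumes "gauge_fun \<alpha>"
    and bound: "\<And>h y. 0 < h \<Longrightarrow> h \<le> 1 \<Longrightarrow> y \<in> approximations F \<alpha> h \<Longrightarrow> norm (y t) \<le> K * \<alpha> h"
  shows "error_coeff F \<alpha> t \<le> ereal K"
proof -
  have "approx_error F \<alpha> t h / ereal (\<alpha> h) \<le> ereal K" if h: "0 < h" "h < 1" for h
  proof -
    \<comment> \<open>Strict monotonicity makes the divisor positive, so the bound survives the
      extended real division.\<close>
    have "\<alpha> 0 < \<alpha> h"
      using assms(1) h unfolding gauge_fun_def by (intro strict_mono_onD[of "{0..}" \<alpha>]) auto
    then have "\<alpha> h > 0"
      using assms(1) by (simp add: gauge_fun_def)
    have "approx_error F \<alpha> t h \<le> ereal (K * \<alpha> h)"
      unfolding approx_error_def using bound h by (intro SUP_least) auto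
    then show ?thesis
      using \<open>\<alpha> h > 0\<close> by (subst ereal_divide_le_pos) (auto simp: mult.commute)
  qed
  moreover have "\<forall>\<^sub>F h in at_right 0. 0 < h \<and> h < (1::real)"
    by (auto simp: eventually_at_right_field intro!: exI[of _ 1])
  ultimately show ?thesis
    unfolding error_coeff_def by (intro Limsup_bounded) (auto elim: eventually_mono)
qed

text \<open>The argument is independent of dimension once the coefficients are bounded operators.
  The constant is built from \<open>\<delta>\<close> and \<open>T\<close> alone, so it can be chosen
  before \<open>\<alpha>\<close> and \<open>t\<close>.\<close>

theorem uniformly_asymptotically_stable_imp_error_coeff_bounded:
  fixes A :: "real \<Rightarrow> 'a::{real_inner, banach} \<Rightarrow>\<^sub>L 'a"
  assumes A: "continuous_on {0..} A"
    and "uniformly_asymptotically_stable (\<lambda>t. blinfun_apply (A t))"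
  shows "\<exists>K::real. K > 0 \<and>
    (\<forall>\<alpha>. gauge_fun \<alpha> \<longrightarrow> (\<forall>t\<ge>0. error_coeff (\<lambda>t. blinfun_apply (A t)) \<alpha> t < ereal K))"
proof -
  let ?F = "\<lambda>t. blinfun_apply (A t)"
  have ev: "evolution_family (sol ?F)"
    by (rule evolution_family_linear_ode[OF A])
  interpret evolution_family "sol ?F" by (rule ev)
  obtain \<delta> where "\<delta> > 0"
    and stable: "\<And>\<tau> \<eta> t. 0 \<le> \<tau> \<Longrightarrow> norm \<eta> < \<delta> \<Longrightarrow> \<tau> \<le> t \<Longrightarrow> norm (sol ?F t \<tau> \<eta>) < 1"
    and attr: "\<forall>\<epsilon>'>0. \<exists>T\<ge>0. \<forall>\<tau>\<ge>0. \<forall>t>\<tau> + T. \<forall>\<eta>. norm \<eta> < \<delta> \<longrightarrow> norm (sol ?F t \<tau> \<eta>) < \<epsilon>'"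
    using conjunct2[OF assms(2)[unfolded uniformly_asymptotically_stable_def],
        THEN spec, THEN mp, OF zero_less_one] by blast
  \<comment> \<open>Attraction to level \<open>\<delta> / 4\<close> gives, after the rescaling
    factor \<open>2 / \<delta>\<close>, the contraction constant 1/2.\<close>
  have "\<delta> / 4 > 0" using \<open>\<delta> > 0\<close> by simp
  obtain T where "T \<ge> 0" and T: "\<And>\<tau> t \<eta>. 0 \<le> \<tau> \<Longrightarrow> \<tau> + T < t \<Longrightarrow> norm \<eta> < \<delta> \<Longrightarrow>
      norm (sol ?F t \<tau> \<eta>) < \<delta> / 4"
    using attr[THEN spec, THEN mp, OF \<open>\<delta> / 4 > 0\<close>] by blast
  have C: "norm (sol ?F t s x) \<le> 2 / \<delta> * norm x" if "0 \<le> s" "s \<le> t" for s t x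
    using linear_norm_le_of_ball[OF linear[OF that] \<open>\<delta> > 0\<close>, of 1] stable that by simp
  have half: "norm (sol ?F t s x) \<le> norm x / 2" if "0 \<le> s" "s + T < t" for s t x
  proof -
    have "s \<le> t" using that \<open>T \<ge> 0\<close> by linarith
    from linear_norm_le_of_ball[OF linear[OF that(1) this] \<open>\<delta> > 0\<close> T[OF that]] \<open>\<delta> > 0\<close>
    show ?thesis by simp
  qed
  define K where "K = 2 * (2 / \<delta>)\<^sup>2 * (T + 2)"
  have "K > 0"
    unfolding K_def using \<open>\<delta> > 0\<close> \<open>T \<ge> 0\<close> by (intro mult_pos_pos) auto
  \<comment> \<open>Adding 1 turns the non-strict bound on the limsup into the strict one
    required.\<close>
  have "error_coeff ?F \<alpha> t < ereal (K + 1)" if \<alpha>: "gauge_fun \<alpha>" and "t \<ge> 0" for \<alpha> t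
  proof -
    have "norm (y t) \<le> K * \<alpha> h" if "0 < h" "h \<le> 1" "y \<in> approximations ?F \<alpha> h" for h y
    proof -
      have "\<alpha> h \<ge> 0" using \<alpha> \<open>0 < h\<close> by (auto simp: gauge_fun_def image_subset_iff)
      then show ?thesis
        unfolding K_def using that \<open>\<delta> > 0\<close> \<open>t \<ge> 0\<close>
        by (intro approximations_norm_le[OF ev C half \<open>T \<ge> 0\<close>]) auto
    qed
    then have "error_coeff ?F \<alpha> t \<le> ereal K"
      by (rule error_coeff_le[OF \<alpha>])
    also have "\<dots> < ereal (K + 1)" by simp
    finally show ?thesis .
  qed
  with \<open>K > 0\<close> show ?thesis
    by (intro exI[of _ "K + 1"]) auto
qed

theorem theorem5p6:
  fixes A :: "real \<Rightarrow> real ^ 'n::finite ^ 'n"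
  assumes "continuous_on {0..} A"
    and "uniformly_asymptotically_stable (\<lambda>t y. A t *v y)"
  shows "\<exists>K::real. K > 0 \<and>
    (\<forall>\<alpha>. gauge_fun \<alpha> \<longrightarrow> (\<forall>t\<ge>0. error_coeff (\<lambda>t y. A t *v y) \<alpha> t < ereal K))"
proof -
  define B where "B t = Blinfun ((*v) (A t))" for t
  have B: "blinfun_apply (B t) = (*v) (A t)" for t
    unfolding B_def by (rule bounded_linear_Blinfun_apply) simp
  \<comment> \<open>In finite dimension, continuity of \<open>A t *v x\<close> for each fixed
    \<open>x\<close> already gives continuity of \<open>B\<close> in operator norm.\<close>
  have "continuous_on {0..} (\<lambda>t. A t *v x)" for x
    unfolding matrix_vector_mult_def
    by (intro continuous_intros continuous_on_vec_lambda assms(1))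
  then have "continuous_on {0..} B"
    by (intro continuous_on_blinfun_componentwise) (simp add: B)
  from uniformly_asymptotically_stable_imp_error_coeff_bounded[OF this] assms(2)
  show ?thesis by (simp add: B)
qed

end
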